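(* Let $\lambda>-1$ be real with $\lambda\neq0$. For every integer $n\ge0$ and all real $x,y$, the bivariate degenerate Hermite polynomials satisfy the differential equation $$\left(x\,\partial_x+\frac{2\lambda}{\log(1+\lambda)}\,y\,\partial_x^2-n\right)H_n(x,y|\lambda)=0.$$
   Context: The bivariate degenerate Hermite polynomials are $$H_n(x,y|\lambda)=\sum_{k=0}^{\lfloor n/2\rfloor}\frac{n!}{(n-2k)!\,k!}\left(\frac{\log(1+\lambda)}{\lambda}\right)^{n-k}x^{n-2k}y^k,$$ equivalently they are given by the generating function $(1+\lambda)^{(xt+yt^2)/\lambda}=\sum_{n\ge0}H_n(x,y|\lambda)\frac{t^n}{n!}$. Here $\log$ is the natural logarithm and $\partial_x$ is the partial derivative in $x$. *)

theory Defs
  imports "HOL-Analysis.Analysis"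
begin

definition degen_hermite :: "real \<Rightarrow> nat \<Rightarrow> real \<Rightarrow> real \<Rightarrow> real" where
  "degen_hermite l n x y =
     (\<Sum>k = 0..n div 2. fact n / (fact (n - 2 * k) * fact k)
        * (ln (1 + l) / l) ^ (n - k) * x ^ (n - 2 * k) * y ^ k)"

text \<open>
  The partial derivative in the first variable. The constant \<open>deriv\<close> is total, with an
  unspecified value where the derivative does not exist; for functions that are polynomial
  in the first variable it is the genuine derivative everywhere.
\<close>

definition partial_x :: "(real \<Rightarrow> real \<Rightarrow> real) \<Rightarrow> real \<Rightarrow> real \<Rightarrow> real" where
  "partial_x F x y = deriv (\<lambda>u. F u y) x"

end

theory Submission
  imports Defs
begin

text \<open>
  Write \<open>a = ln (1 + l) / l\<close>, which is nonzero, and let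
  \<open>T k = n! / ((n - 2k)! k!) * a^(n - k) * x^(n - 2k) * y^k\<close> be the summands of the polynomial.
  The Euler operator \<open>x \<partial>\<^sub>x\<close> multiplies \<open>T k\<close> by \<open>n - 2k\<close>, so \<open>x \<partial>\<^sub>x - n\<close> multiplies it
  by \<open>- 2k\<close>. The operator \<open>(2 / a) y \<partial>\<^sub>x\<^sup>2\<close> lowers the degree in \<open>x\<close> by two and raises that
  in \<open>y\<close> by one; comparing coefficients, it sends \<open>T k\<close> to \<open>2 (k + 1) T (k + 1)\<close>, and it kills
  the last summand, whose degree in \<open>x\<close> is at most one. The sum of
  \<open>2 (k + 1) T (k + 1) - 2 k T k\<close> therefore telescopes, and both of its ends vanish.
\<close>

lemma partial_x_sum_monomials:
  fixes c :: "nat \<Rightarrow> real" and d :: "nat \<Rightarrow> nat"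
  shows "partial_x (\<lambda>x y. \<Sum>k\<in>A. c k * x ^ d k * y ^ k) =
    (\<lambda>x y. \<Sum>k\<in>A. (c k * real (d k)) * x ^ (d k - 1) * y ^ k)"
proof (intro ext)
  fix x y :: real
  have "((\<lambda>u. \<Sum>k\<in>A. c k * u ^ d k * y ^ k) has_real_derivative
      (\<Sum>k\<in>A. (c k * real (d k)) * x ^ (d k - 1) * y ^ k)) (at x)"
    by (auto intro!: derivative_eq_intros sum.cong)
  then show "partial_x (\<lambda>x y. \<Sum>k\<in>A. c k * x ^ d k * y ^ k) x y =
      (\<Sum>k\<in>A. (c k * real (d k)) * x ^ (d k - 1) * y ^ k)"
    unfolding partial_x_def by (rule DERIV_imp_deriv)
qed

definition degen_hermite_coeff :: "real \<Rightarrow> nat \<Rightarrow> nat \<Rightarrow> real" where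
  "degen_hermite_coeff a n k = fact n / (fact (n - 2 * k) * fact k) * a ^ (n - k)"

text \<open>
  Passing from \<open>k\<close> to \<open>k + 1\<close> removes the two top factors \<open>(n - 2k) (n - 2k - 1)\<close> of
  \<open>(n - 2k)!\<close>, which are the ones that differentiating \<open>x^(n - 2k)\<close> twice produces.
\<close>

lemma degen_hermite_coeff_Suc:
  fixes a :: real
  assumes "a \<noteq> 0" and "2 * k + 2 \<le> n"
  shows "degen_hermite_coeff a n k * real (n - 2 * k) * real (n - 2 * k - 1) =
    a * real (k + 1) * degen_hermite_coeff a n (k + 1)"
proof -
  obtain j where n: "n = 2 * k + 2 + j"
    using assms(2) le_Suc_ex by blast
  have "n - 2 * k = Suc (Suc j)" "n - 2 * (k + 1) = j"
      "n - k = Suc (k + 1 + j)" "n - (k + 1) = k + 1 + j"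
    using n by auto
  then show ?thesis
    unfolding degen_hermite_coeff_def
    by (simp add: divide_simps del: of_nat_Suc)
qed

theorem corollary1:
  fixes l x y :: real and n :: nat
  assumes "l > -1" and "l \<noteq> 0"
  shows "x * partial_x (degen_hermite l n) x y
       + 2 * l / ln (1 + l) * y * (partial_x ^^ 2) (degen_hermite l n) x y
       - real n * degen_hermite l n x y = 0"
proof -
  define a where "a = ln (1 + l) / l"
  define m where "m = n div 2"
  define c where "c = degen_hermite_coeff a n"
  define d where "d k = n - 2 * k" for k
  have a0: "a \<noteq> 0"
    using assms by (simp add: a_def)
  have inv: "2 * l / ln (1 + l) = 2 / a"
    by (simp add: a_def)
  have H: "degen_hermite l n = (\<lambda>x y. \<Sum>k=0..m. c k * x ^ d k * y ^ k)"
    by (intro ext) (simp add: degen_hermite_def degen_hermite_coeff_def a_def m_def c_def d_def)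
  have H1: "partial_x (degen_hermite l n) =
      (\<lambda>x y. \<Sum>k=0..m. (c k * real (d k)) * x ^ (d k - 1) * y ^ k)"
    unfolding H by (rule partial_x_sum_monomials)
  have H2: "(partial_x ^^ 2) (degen_hermite l n) =
      (\<lambda>x y. \<Sum>k=0..m. (c k * real (d k) * real (d k - 1)) * x ^ (d k - 1 - 1) * y ^ k)"
    using partial_x_sum_monomials[of "\<lambda>k. c k * real (d k)" "\<lambda>k. d k - 1" "{0..m}"]
    by (simp add: numeral_2_eq_2 H1)
  \<comment> \<open>Truncating at \<open>m\<close> matters: under natural subtraction the formula for the summand
    need not vanish at \<open>m + 1\<close>.\<close>
  define f where "f k = (if k \<le> m then 2 * real k * (c k * x ^ d k * y ^ k) else 0)" for k
  have step: "x * ((c k * real (d k)) * x ^ (d k - 1) * y ^ k)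
      + 2 / a * y * ((c k * real (d k) * real (d k - 1)) * x ^ (d k - 1 - 1) * y ^ k)
      - real n * (c k * x ^ d k * y ^ k) = f (Suc k) - f k" if "k \<le> m" for k
  proof -
    have "real (d k) * (x * x ^ (d k - 1)) = real (d k) * x ^ d k"
      by (cases "d k") auto
    moreover have "real (d k) = real n - 2 * real k"
      using that by (simp add: d_def m_def of_nat_diff)
    ultimately have euler: "x * ((c k * real (d k)) * x ^ (d k - 1) * y ^ k)
        = (real n - 2 * real k) * (c k * x ^ d k * y ^ k)"
      by (metis (no_types, opaque_lifting) mult.assoc mult.left_commute)
    have raise: "2 / a * y * ((c k * real (d k) * real (d k - 1)) * x ^ (d k - 1 - 1) * y ^ k)
        = f (Suc k)"
    proof (cases "k < m")
      case True
      then have "2 * k + 2 \<le> n"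
        by (simp add: m_def)
      then have "c k * real (d k) * real (d k - 1) = a * real (k + 1) * c (k + 1)"
        unfolding c_def d_def by (rule degen_hermite_coeff_Suc[OF a0])
      moreover have "d k - 1 - 1 = d (Suc k)"
        by (simp add: d_def)
      ultimately show ?thesis
        using True a0 by (simp add: f_def)
    next
      case False
      then have "d k \<le> 1"
        using that by (simp add: d_def m_def)
      then have "real (d k) * real (d k - 1) = 0"
        by simp
      then show ?thesis
        using False by (simp add: f_def)
    qed
    show ?thesis
      unfolding euler raise using that by (simp add: f_def algebra_simps)
  qed
  have "x * partial_x (degen_hermite l n) x y
       + 2 * l / ln (1 + l) * y * (partial_x ^^ 2) (degen_hermite l n) x y
       - real n * degen_hermite l n x y
     = (\<Sum>k=0..m. x * ((c k * real (d k)) * x ^ (d k - 1) * y ^ k)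
      + 2 / a * y * ((c k * real (d k) * real (d k - 1)) * x ^ (d k - 1 - 1) * y ^ k)
      - real n * (c k * x ^ d k * y ^ k))"
    unfolding H1 H2 inv unfolding H
    by (simp only: sum_distrib_left sum.distrib sum_subtractf)
  also have "\<dots> = (\<Sum>k=0..m. f (Suc k) - f k)"
    by (intro sum.cong refl step) simp
  also have "\<dots> = f (Suc m) - f 0"
    by (rule sum_Suc_diff) simp
  also have "\<dots> = 0"
    by (simp add: f_def)
  finally show ?thesis .
qed

end
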